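(* Let $d\ge1$ and let $F:\mathbb{N}\to\mathbb{R}^+$ be any function with $\lim_{L\to\infty}F_L/L^d=0$. Then there exists a Lebesgue measurable set $\mathbb{M}\subset\mathbb{T}^d$ such that the entropy $S_L$ of the pure translation-invariant quasi-free state $\omega_{\mathbb{M}}$ restricted to $\{1,\dots,L\}^d$ satisfies $S_L\ge F_L$ for all sufficiently large $L$.
   Context: $\mathbb{T}^d=(\mathbb{R}/2\pi\mathbb{Z})^d$ is the $d$-dimensional torus, parametrized by $[-\pi,\pi)^d$, with Lebesgue measure $|\cdot|$. For a measurable set $\mathbb{M}\subset\mathbb{T}^d$ with characteristic function $\chi_{\mathbb{M}}$, define the infinite matrix $Q$ indexed by $\mathbf{k},\mathbf{l}\in\mathbb{Z}^d$ by $$Q_{\mathbf{k},\mathbf{l}}=\frac{1}{(2\pi)^d}\int_{[-\pi,\pi)^d}\chi_{\mathbb{M}}(\mathbf{a})\,e^{-i(\mathbf{l}-\mathbf{k})\cdot\mathbf{a}}\,d\mathbf{a}.$$ This $Q$ is the symbol of the pure, translation- and gauge-invariant quasi-free state $\omega_{\mathbb{M}}$ on the CAR algebra over $\ell^2(\mathbb{Z}^d)$. For an integer $L\ge1$ let $Q_L$ be the $L^d\times L^d$ submatrix $(Q_{\mathbf{k},\mathbf{l}})_{\mathbf{k},\mathbf{l}\in\{1,\dots,L\}^d}$, and $$S_L=-\operatorname{Tr}\big(Q_L\ln Q_L+(\mathbb{1}-Q_L)\ln(\mathbb{1}-Q_L)\big)$$ (with $0\ln0=0$), the von Neumann entropy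 of the restriction of $\omega_{\mathbb{M}}$ to $\{1,\dots,L\}^d$. *)

theory Defs
  imports "HOL-Analysis.Analysis" "HOL-Computational_Algebra.Polynomial"
begin

definition torus_box :: "(real^'d::finite) set" where
  "torus_box = {a. \<forall>i. - pi \<le> a $ i \<and> a $ i < pi}"

text \<open>Symbol Q of the quasi-free state omega_M, indexed by k, l in Z^d.\<close>
definition symbolQ :: "(real^'d::finite) set \<Rightarrow> ('d \<Rightarrow> int) \<Rightarrow> ('d \<Rightarrow> int) \<Rightarrow> complex" where
  "symbolQ M k l = complex_of_real (1 / (2 * pi) ^ CARD('d)) *
     integral\<^sup>L lebesgue (\<lambda>a. indicator M a *\<^sub>R
        exp (- \<i> * complex_of_real (\<Sum>i\<in>UNIV. real_of_int (l i - k i) * a $ i)))"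

definition index_box :: "nat \<Rightarrow> ('d::finite \<Rightarrow> int) set" where
  "index_box L = {k. \<forall>i. k i \<in> {1..int L}}"

definition charpoly_QL :: "(real^'d::finite) set \<Rightarrow> nat \<Rightarrow> complex poly" where
  "charpoly_QL M L = (\<Sum>\<sigma> | \<sigma> permutes index_box L. of_int (sign \<sigma>) *
     (\<Prod>k\<in>index_box L. (if \<sigma> k = k then [:- symbolQ M k k, 1:] else [:- symbolQ M k (\<sigma> k):])))"

definition xlnx :: "real \<Rightarrow> real" where
  "xlnx x = (if x = 0 then 0 else x * ln x)"

text \<open>S_L = -Tr(Q_L ln Q_L + (1-Q_L) ln(1-Q_L)), computed as the sum over the eigenvalues of
  Q_L (roots of the characteristic polynomial, counted with algebraic multiplicity).
  Q_L is Hermitian, so its eigenvalues are real (in [0,1]).\<close>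
definition entropy_SL :: "(real^'d::finite) set \<Rightarrow> nat \<Rightarrow> real" where
  "entropy_SL M L = - (\<Sum>z\<in>{z. poly (charpoly_QL M L) z = 0}.
      real (order z (charpoly_QL M L)) * (xlnx (Re z) + xlnx (1 - Re z)))"

end

theory Submission
  imports Defs "Jordan_Normal_Form.Schur_Decomposition"
begin

text \<open>Since \<open>- x ln x - (1 - x) ln (1 - x) \<ge> 2 x (1 - x)\<close> on \<open>[0, 1]\<close>, the entropy is at least
  \<open>2 Tr (Q\<^sub>L - Q\<^sub>L\<^sup>2)\<close>. For a set that restricts only one coordinate, to \<open>A \<subseteq> [-\<pi>, \<pi>)\<close>, each
  diagonal entry of \<open>Q\<^sub>L - Q\<^sub>L\<^sup>2\<close> dominates a tail \<open>a\<^sub>0 - \<Sum>|a\<^sub>n|\<^sup>2\<close> of the Fourier coefficients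
  of the indicator of \<open>A\<close>, where \<open>n\<close> runs over at most \<open>L\<close> frequencies of size at most \<open>L\<close>. Inside
  the dyadic interval \<open>[2\<^bsup>-j-1\<^esup>, 2\<^bsup>-j\<^esup>)\<close> let \<open>A\<close> consist of stripes so thin that frequencies up to the
  \<open>(j+1)\<close>-st threshold do not see them: up to that threshold the tail stays above a multiple of \<open>2\<^bsup>-j\<^esup>\<close>.
  The thresholds are chosen such that \<open>F\<^sub>L / L\<^sup>d\<close> is below this multiple of \<open>2\<^bsup>-j\<^esup>\<close> from the \<open>j\<close>-th
  one on.\<close>

subsection \<open>Eigenvalues and traces\<close>

text \<open>The Leibniz expansion of det(X - Q) used by \<open>charpoly_QL\<close>, freed from the
  particular index set and kernel so that it can be transported along an enumeration of
  \<open>S\<close> to a matrix with numerical indices.\<close>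

definition char_sum :: "'a set \<Rightarrow> ('a \<Rightarrow> 'a \<Rightarrow> 'c::comm_ring_1) \<Rightarrow> 'c poly" where
  "char_sum S Q = (\<Sum>\<sigma> | \<sigma> permutes S. of_int (sign \<sigma>) *
     (\<Prod>k\<in>S. (if \<sigma> k = k then [:- Q k k, 1:] else [:- Q k (\<sigma> k):])))"

text \<open>Conjugation by \<open>f\<close> maps the permutations of \<open>{0..<n}\<close>
  bijectively onto those of \<open>S\<close> and preserves signs, so the two Leibniz sums agree term
  by term.\<close>

lemma char_sum_eq_char_poly:
  assumes f: "bij_betw f {0..<n} S"
  shows "char_sum S Q = char_poly (mat n n (\<lambda>(i, j). Q (f i) (f j)))"
proof -
  let ?m = "map_permutation {0..<n} f"
  have inj: "inj_on f {0..<n}" and im: "f ` {0..<n} = S"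
    using f by (auto simp: bij_betw_def)
  have bij: "bij_betw ?m {p. p permutes {0..<n}} {p. p permutes S}"
  proof (rule bij_betwI[where g = "map_permutation S (inv_into {0..<n} f)"])
    show "?m \<in> {p. p permutes {0..<n}} \<rightarrow> {p. p permutes S}"
      using map_permutation_permutes[OF f] by auto
    show "map_permutation S (inv_into {0..<n} f) \<in> {p. p permutes S} \<rightarrow> {p. p permutes {0..<n}}"
      using map_permutation_permutes[OF bij_betw_inv_into[OF f]] by auto
    show "map_permutation S (inv_into {0..<n} f) (?m p) = p" if "p \<in> {p. p permutes {0..<n}}" for p
      using that f by (intro map_permutation_compose_inv) (auto simp: bij_betw_inv_into_left)
    show "?m (map_permutation S (inv_into {0..<n} f) p) = p" if "p \<in> {p. p permutes S}" for p
      using that f bij_betw_inv_into[OF f]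
      by (intro map_permutation_compose_inv) (auto simp: bij_betw_inv_into_right)
  qed
  have "char_sum S Q = (\<Sum>p | p permutes {0..<n}. of_int (sign (?m p)) *
     (\<Prod>k\<in>S. (if ?m p k = k then [:- Q k k, 1:] else [:- Q k (?m p k):])))"
    unfolding char_sum_def by (rule sum.reindex_bij_betw[OF bij, symmetric])
  also have "\<dots> = (\<Sum>p | p permutes {0..<n}. signof p *
     (\<Prod>i = 0..<n. char_poly_matrix (mat n n (\<lambda>(i, j). Q (f i) (f j))) $$ (i, p i)))"
  proof (rule sum.cong[OF refl])
    fix p assume "p \<in> {p. p permutes {0..<n}}"
    then have p: "p permutes {0..<n}" by simp
    have "(\<Prod>k\<in>S. (if ?m p k = k then [:- Q k k, 1:] else [:- Q k (?m p k):])) =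
      (\<Prod>i = 0..<n. (if ?m p (f i) = f i then [:- Q (f i) (f i), 1:] else [:- Q (f i) (?m p (f i)):]))"
      by (rule prod.reindex_bij_betw[OF f, symmetric])
    also have "\<dots> = (\<Prod>i = 0..<n. char_poly_matrix (mat n n (\<lambda>(i, j). Q (f i) (f j))) $$ (i, p i))"
    proof (rule prod.cong[OF refl])
      fix i assume i: "i \<in> {0..<n}"
      then have pi: "p i \<in> {0..<n}" using p by (simp add: permutes_in_image)
      \<comment> \<open>Injectivity of \<open>f\<close> makes the fixed points of the two
        permutations correspond, so the variable X appears in the same factors on both
        sides.\<close>
      have eq: "f (p i) = f i \<longleftrightarrow> p i = i" using inj i pi by (auto simp: inj_on_def)
      show "(if ?m p (f i) = f i then [:- Q (f i) (f i), 1:] else [:- Q (f i) (?m p (f i)):]) =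
        char_poly_matrix (mat n n (\<lambda>(i, j). Q (f i) (f j))) $$ (i, p i)"
        using i pi eq by (auto simp: char_poly_matrix_def map_permutation_apply[OF inj i])
    qed
    finally show "of_int (sign (?m p)) *
        (\<Prod>k\<in>S. (if ?m p k = k then [:- Q k k, 1:] else [:- Q k (?m p k):])) =
      signof p * (\<Prod>i = 0..<n. char_poly_matrix (mat n n (\<lambda>(i, j). Q (f i) (f j))) $$ (i, p i))"
      using sign_map_permutation[OF inj p] by simp
  qed
  also have "\<dots> = char_poly (mat n n (\<lambda>(i, j). Q (f i) (f j)))"
    unfolding char_poly_def by (subst det_def'[of _ n]) auto
  finally show ?thesis .
qed

lemma sum_diag_mult:
  fixes A B :: "'a :: comm_ring_1 mat"
  assumes "A \<in> carrier_mat n n" "B \<in> carrier_mat n n"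
  shows "(\<Sum>i<n. (A * B) $$ (i, i)) = (\<Sum>i<n. \<Sum>j<n. A $$ (i, j) * B $$ (j, i))"
  using assms by (intro sum.cong) (auto simp: scalar_prod_def lessThan_atLeast0)

lemma sum_diag_mult_commute:
  fixes A B :: "'a :: comm_ring_1 mat"
  assumes "A \<in> carrier_mat n n" "B \<in> carrier_mat n n"
  shows "(\<Sum>i<n. (A * B) $$ (i, i)) = (\<Sum>i<n. (B * A) $$ (i, i))"
proof -
  show ?thesis
    unfolding sum_diag_mult[OF assms] sum_diag_mult[OF assms(2,1)]
    by (subst sum.swap) (simp add: mult.commute)
qed

text \<open>Cyclicity of the trace. It is applied to a matrix and to its square, to read both traces
  off a triangular form.\<close>

lemma sum_diag_conjugate:
  fixes B P R :: "'a :: comm_ring_1 mat"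
  assumes [simp]: "P \<in> carrier_mat n n" "B \<in> carrier_mat n n" "R \<in> carrier_mat n n"
    and RP: "R * P = 1\<^sub>m n"
  shows "(\<Sum>i<n. (P * B * R) $$ (i, i)) = (\<Sum>i<n. B $$ (i, i))"
proof -
  have "(\<Sum>i<n. (P * B * R) $$ (i, i)) = (\<Sum>i<n. (R * (P * B)) $$ (i, i))"
    using mult_carrier_mat[OF assms(1,2)] by (intro sum_diag_mult_commute) auto
  also have "R * (P * B) = (R * P) * B" by (rule assoc_mult_mat[OF assms(3,1,2), symmetric])
  also have "\<dots> = B" using left_mult_one_mat[OF assms(2)] RP by simp
  finally show ?thesis .
qed

text \<open>By Schur, \<open>A\<close> is similar to an upper triangular \<open>B\<close>. The list
  \<open>as\<close> is the diagonal of \<open>B\<close>: the eigenvalues with multiplicity. The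
  traces of A and A^2 are invariant under similarity, and the diagonal of B^2 consists of the
  squares of the diagonal of \<open>B\<close>.\<close>

lemma char_poly_trace_factorization:
  fixes A :: "complex mat"
  assumes A: "A \<in> carrier_mat n n"
  obtains as where "char_poly A = (\<Prod>a\<leftarrow>as. [:- a, 1:])"
    "sum_list as = (\<Sum>i<n. A $$ (i, i))"
    "sum_list (map (\<lambda>a. a\<^sup>2) as) = (\<Sum>i<n. \<Sum>j<n. A $$ (i, j) * A $$ (j, i))"
proof -
  obtain es where "char_poly A = (\<Prod>a\<leftarrow>es. [:- a, 1:])"
    using char_poly_factorized[OF A] by blast
  from schur_decomposition_exists[OF A this] obtain B where B: "B \<in> carrier_mat n n"
    and ut: "upper_triangular B" and sim: "similar_mat A B" by blast
  from sim A obtain P R where P: "P \<in> carrier_mat n n" and R: "R \<in> carrier_mat n n"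
    and RP: "R * P = 1\<^sub>m n" and eq: "A = P * B * R"
    unfolding similar_mat_def similar_mat_wit_def Let_def by auto
  have diag: "diag_mat B = map (\<lambda>i. B $$ (i, i)) [0..<n]"
    using B by (simp add: diag_mat_def)
  have sq: "A * A = P * (B * B) * R"
  proof -
    have "A * A = P * B * (R * P) * (B * R)"
      unfolding eq using P B R
      by (simp add: assoc_mult_mat[of _ n n _ n _ n])
    also have "\<dots> = P * (B * B) * R"
      unfolding RP using P B R by (simp add: assoc_mult_mat[of _ n n _ n _ n])
    finally show ?thesis .
  qed
  show ?thesis
  proof
    show "char_poly A = (\<Prod>a\<leftarrow>diag_mat B. [:- a, 1:])"
      using char_poly_similar[OF sim] char_poly_upper_triangular[OF B ut] by simp
    show "sum_list (diag_mat B) = (\<Sum>i<n. A $$ (i, i))"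
      using sum_diag_conjugate[OF P B R RP] unfolding diag eq
      by (simp add: interv_sum_list_conv_sum_set_nat lessThan_atLeast0)
    have "(\<Sum>i<n. \<Sum>j<n. A $$ (i, j) * A $$ (j, i)) = (\<Sum>i<n. (B * B) $$ (i, i))"
      unfolding sum_diag_mult[OF A A, symmetric] sq using sum_diag_conjugate[OF P _ R RP, of "B * B"] B by simp
    also have "\<dots> = (\<Sum>i<n. \<Sum>j<n. if j = i then (B $$ (i, i))\<^sup>2 else 0)"
      unfolding sum_diag_mult[OF B B]
    proof (intro sum.cong refl)
      fix i j assume "i \<in> {..<n}" "j \<in> {..<n}"
      \<comment> \<open>For distinct \<open>i\<close> and \<open>j\<close> one of the two positions
        lies below the diagonal of \<open>B\<close>.\<close>
      then have "i = j \<or> B $$ (i, j) = 0 \<or> B $$ (j, i) = 0"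
        using ut B by (metis carrier_matD(1) lessThan_iff linorder_neqE_nat upper_triangularD)
      then show "B $$ (i, j) * B $$ (j, i) = (if j = i then (B $$ (i, i))\<^sup>2 else 0)"
        by (auto simp: power2_eq_square)
    qed
    finally show "sum_list (map (\<lambda>a. a\<^sup>2) (diag_mat B)) = (\<Sum>i<n. \<Sum>j<n. A $$ (i, j) * A $$ (j, i))"
      unfolding diag by (simp add: interv_sum_list_conv_sum_set_nat lessThan_atLeast0 o_def)
  qed
qed

lemma order_prod_linear_factors:
  fixes as :: "'a :: idom list"
  shows "Polynomial.order z (\<Prod>a\<leftarrow>as. [:- a, 1:]) = count_list as z"
proof (induction as)
  case (Cons a as)
  have "[:- a, 1:] * (\<Prod>a\<leftarrow>as. [:- a, 1:]) \<noteq> 0"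
    unfolding mult_eq_0_iff by (auto simp: prod_list_zero_iff)
  from order_mult[OF this, of z] show ?case
    using Cons by (simp add: order_linear')
qed simp

text \<open>Turns the shape of \<open>entropy_SL\<close>, a sum over distinct roots weighted by
  their order, into a sum over the list of eigenvalues with repetition.\<close>

lemma sum_roots_order:
  fixes as :: "complex list" and g :: "complex \<Rightarrow> real"
  defines "p \<equiv> (\<Prod>a\<leftarrow>as. [:- a, 1:])"
  shows "(\<Sum>z | poly p z = 0. real (Polynomial.order z p) * g z) = sum_list (map g as)"
proof -
  have "{z. poly p z = 0} = set as"
    unfolding p_def by (auto simp: poly_prod_list prod_list_zero_iff)
  moreover have "(\<Sum>z\<in>set as. real (count_list as z) * g z) = sum_list (map g as)"
  proof (induction as)
    case (Cons a as)
    have "(\<Sum>z\<in>set (a # as). real (count_list (a # as) z) * g z)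
        = (\<Sum>z\<in>insert a (set as). real (count_list as z) * g z + (if z = a then g a else 0))"
      by (intro sum.cong) (auto simp: algebra_simps)
    also have "\<dots> = (\<Sum>z\<in>insert a (set as). real (count_list as z) * g z) + g a"
      by (simp add: sum.distrib del: sum.insert)
    \<comment> \<open>If \<open>a\<close> does not occur in \<open>as\<close>, its count is 0, so
      including it in the range of summation changes nothing.\<close>
    also have "(\<Sum>z\<in>insert a (set as). real (count_list as z) * g z) = (\<Sum>z\<in>set as. real (count_list as z) * g z)"
      by (cases "a \<in> set as") (auto simp: insert_absorb)
    finally show ?case using Cons by simp
  qed simp
  ultimately show ?thesis
    unfolding p_def order_prod_linear_factors by simp
qed

section \<open>Bounding the entropy below by 2 Tr(Q - Q^2)\<close>

lemma xlnx_entropy_ge: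
  assumes "0 \<le> x" "x \<le> 1"
  shows "- (xlnx x + xlnx (1 - x)) \<ge> 2 * (x * (1 - x))"
proof -
  \<comment> \<open>This is ln y <= y - 1 multiplied by y. Adding the cases y = x and y = 1 - x
    gives the factor 2.\<close>
  have *: "xlnx y \<le> - (y * (1 - y))" if "0 \<le> y" for y
  proof (cases "y = 0")
    case False
    then have "ln y \<le> y - 1" using that by (intro ln_le_minus_one) auto
    then have "y * ln y \<le> y * (y - 1)" using that by (intro mult_left_mono) auto
    then show ?thesis using False by (simp add: xlnx_def algebra_simps)
  qed (simp add: xlnx_def)
  show ?thesis using *[of x] *[of "1 - x"] assms by (simp add: algebra_simps)
qed

text \<open>A root \<open>z\<close> has an eigenvector \<open>u\<close>, on which the quadratic form
  takes the value z |u|^2. Hence \<open>z\<close> is the Rayleigh quotient of \<open>u\<close>. The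
  assumption \<open>form\<close> expresses 0 <= Q <= 1 and places this quotient in [0, 1].\<close>

lemma root_char_sum_real:
  fixes Q :: "'a \<Rightarrow> 'a \<Rightarrow> complex"
  assumes fin: "finite S"
    and form: "\<And>u. \<exists>r. (\<Sum>k\<in>S. \<Sum>l\<in>S. cnj (u k) * Q k l * u l) = complex_of_real r \<and>
                     0 \<le> r \<and> r \<le> (\<Sum>k\<in>S. (cmod (u k))\<^sup>2)"
    and root: "poly (char_sum S Q) z = 0"
  shows "Im z = 0 \<and> 0 \<le> Re z \<and> Re z \<le> 1"
proof -
  obtain f where f: "bij_betw f {0..<card S} S" using ex_bij_betw_nat_finite[OF fin] by blast
  let ?n = "card S"
  define A where "A = mat ?n ?n (\<lambda>(i, j). Q (f i) (f j))"
  have A: "A \<in> carrier_mat ?n ?n" by (simp add: A_def)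
  have "poly (char_poly A) z = 0" using root char_sum_eq_char_poly[OF f, of Q] by (simp add: A_def)
  then have "eigenvalue A z" using eigenvalue_root_char_poly[OF A] by simp
  then obtain v where v: "v \<in> carrier_vec ?n" "v \<noteq> 0\<^sub>v ?n" "A *\<^sub>v v = z \<cdot>\<^sub>v v"
    unfolding eigenvalue_def eigenvector_def using A by auto
  define u where "u k = vec_index v (inv_into {0..<?n} f k)" for k
  have uf: "u (f i) = vec_index v i" if "i < ?n" for i
    using that f by (simp add: u_def bij_betw_inv_into_left)
  have ev: "(\<Sum>l\<in>S. Q k l * u l) = z * u k" if k: "k \<in> S" for k
  proof -
    obtain i where i: "i < ?n" "k = f i" using bij_betw_imp_surj_on[OF f] k by (metis atLeastLessThan_iff imageE)
    have "(\<Sum>l\<in>S. Q k l * u l) = (\<Sum>j = 0..<?n. Q k (f j) * u (f j))"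
      by (rule sum.reindex_bij_betw[OF f, symmetric])
    also have "\<dots> = vec_index (A *\<^sub>v v) i"
      using i v(1) uf by (auto simp: A_def scalar_prod_def intro!: sum.cong)
    also have "\<dots> = z * u k" using i v uf by simp
    finally show ?thesis .
  qed
  let ?N = "\<Sum>k\<in>S. (cmod (u k))\<^sup>2"
  obtain r where r: "(\<Sum>k\<in>S. \<Sum>l\<in>S. cnj (u k) * Q k l * u l) = complex_of_real r"
    "0 \<le> r" "r \<le> ?N" using form by blast
  have "(\<Sum>k\<in>S. \<Sum>l\<in>S. cnj (u k) * Q k l * u l) = (\<Sum>k\<in>S. cnj (u k) * (z * u k))"
    by (intro sum.cong refl) (simp add: ev[symmetric] sum_distrib_left mult.assoc)
  also have "\<dots> = z * complex_of_real ?N"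
    by (simp add: sum_distrib_left complex_norm_square mult_ac del: of_real_power)
  finally have zr: "z * complex_of_real ?N = complex_of_real r" using r by simp
  obtain i where i: "i < ?n" "vec_index v i \<noteq> 0" using v(1,2)
    by (metis carrier_vecD eq_vecI index_zero_vec)
  have "f i \<in> S" using f i by (auto simp: bij_betw_def)
  then have "?N > 0" using i uf fin by (intro sum_pos2[of _ "f i"]) auto
  then have "z = complex_of_real (r / ?N)"
    using zr nonzero_eq_divide_eq[of "complex_of_real ?N" z "complex_of_real r"]
    by (simp del: of_real_sum)
  then show ?thesis using r \<open>?N > 0\<close> by simp
qed

text \<open>The sum on the right is Tr(Q - Q^2), which equals the sum of z (1 - z) over the
  eigenvalues. As these are real and lie in [0, 1], the pointwise bound
  \<open>xlnx_entropy_ge\<close> applies to each of them.\<close>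

lemma entropy_char_sum_ge:
  fixes Q :: "'a \<Rightarrow> 'a \<Rightarrow> complex"
  assumes fin: "finite S"
    and form: "\<And>u. \<exists>r. (\<Sum>k\<in>S. \<Sum>l\<in>S. cnj (u k) * Q k l * u l) = complex_of_real r \<and>
                     0 \<le> r \<and> r \<le> (\<Sum>k\<in>S. (cmod (u k))\<^sup>2)"
  shows "- (\<Sum>z | poly (char_sum S Q) z = 0.
            real (Polynomial.order z (char_sum S Q)) * (xlnx (Re z) + xlnx (1 - Re z)))
         \<ge> 2 * Re (\<Sum>k\<in>S. Q k k - (\<Sum>l\<in>S. Q k l * Q l k))"
proof -
  obtain f where f: "bij_betw f {0..<card S} S" using ex_bij_betw_nat_finite[OF fin] by blast
  let ?n = "card S"
  define A where "A = mat ?n ?n (\<lambda>(i, j). Q (f i) (f j))"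
  have A: "A \<in> carrier_mat ?n ?n" by (simp add: A_def)
  have cp: "char_sum S Q = char_poly A"
    using char_sum_eq_char_poly[OF f, of Q] by (simp add: A_def)
  obtain as where as: "char_poly A = (\<Prod>a\<leftarrow>as. [:- a, 1:])"
    "sum_list as = (\<Sum>i<?n. A $$ (i, i))"
    "sum_list (map (\<lambda>a. a\<^sup>2) as) = (\<Sum>i<?n. \<Sum>j<?n. A $$ (i, j) * A $$ (j, i))"
    by (rule char_poly_trace_factorization[OF A])
  have real: "Im a = 0 \<and> 0 \<le> Re a \<and> Re a \<le> 1" if "a \<in> set as" for a
  proof (rule root_char_sum_real[OF fin form])
    show "poly (char_sum S Q) a = 0"
      unfolding cp as(1) using that by (auto simp: poly_prod_list prod_list_zero_iff)
  qed
  have tr1: "(\<Sum>k\<in>S. Q k k) = sum_list as"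
    unfolding as(2) sum.reindex_bij_betw[OF f, symmetric]
    by (simp add: A_def lessThan_atLeast0)
  have tr2: "(\<Sum>k\<in>S. \<Sum>l\<in>S. Q k l * Q l k) = sum_list (map (\<lambda>a. a\<^sup>2) as)"
    unfolding as(3) sum.reindex_bij_betw[OF f, symmetric]
    by (simp add: A_def lessThan_atLeast0)
  have "2 * Re (\<Sum>k\<in>S. Q k k - (\<Sum>l\<in>S. Q k l * Q l k)) =
      2 * Re (sum_list as - sum_list (map (\<lambda>a. a\<^sup>2) as))"
    by (simp add: sum_subtractf tr1[symmetric] tr2[symmetric])
  also have "\<dots> = sum_list (map (\<lambda>a. 2 * Re (a - a\<^sup>2)) as)"
    by (induction as) (auto simp: algebra_simps)
  also have "\<dots> \<le> sum_list (map (\<lambda>a. - (xlnx (Re a) + xlnx (1 - Re a))) as)"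
  proof (rule sum_list_mono)
    fix a assume "a \<in> set as"
    from real[OF this] have a: "Im a = 0" "0 \<le> Re a" "Re a \<le> 1" by auto
    \<comment> \<open>Reality of the eigenvalue enters here: without it, Re(a^2) would differ from
      (Re a)^2.\<close>
    then have "Re (a - a\<^sup>2) = Re a * (1 - Re a)"
      by (simp add: power2_eq_square algebra_simps)
    then show "2 * Re (a - a\<^sup>2) \<le> - (xlnx (Re a) + xlnx (1 - Re a))"
      using xlnx_entropy_ge[OF a(2,3)] by simp
  qed
  also have "\<dots> = - sum_list (map (\<lambda>a. xlnx (Re a) + xlnx (1 - Re a)) as)"
    by (induction as) auto
  finally show ?thesis unfolding cp as(1) sum_roots_order by simp
qed

subsection \<open>Fourier coefficients and square waves\<close>

text \<open>The integral extends over the whole line, so this is the Fourier coefficient on the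
  circle only for functions that vanish outside [-pi, pi). The lemmas below assume this wherever it
  matters.\<close>

definition fourier_coeff :: "(real \<Rightarrow> real) \<Rightarrow> int \<Rightarrow> complex" where
  "fourier_coeff h n = complex_of_real (1 / (2 * pi)) *
     integral\<^sup>L lborel (\<lambda>x. h x *\<^sub>R exp (- \<i> * complex_of_real (of_int n * x)))"

lemma norm_exp_minus_i [simp]: "cmod (exp (- (\<i> * complex_of_real t))) = 1"
  using norm_exp_i_times[of "- t"] by simp

lemma integrable_bounded_support:
  fixes f :: "'a::euclidean_space \<Rightarrow> 'b::{banach, second_countable_topology}"
  assumes E: "E \<in> sets borel" "emeasure lborel E < \<infinity>"
    and f: "f \<in> borel_measurable borel" "\<And>x. norm (f x) \<le> B" "\<And>x. x \<notin> E \<Longrightarrow> f x = 0"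
  shows "integrable lborel f"
proof -
  have "integrable lborel (\<lambda>x. indicator E x *\<^sub>R f x)"
    by (rule integrableI_bounded_set_indicator[where B = B]) (use assms in auto)
  moreover have "(\<lambda>x. indicator E x *\<^sub>R f x) = f"
    using f(3) by (auto simp: indicator_def)
  ultimately show ?thesis by simp
qed

lemma has_integral_fourier_coeff:
  assumes h: "h \<in> borel_measurable borel" "\<And>x. \<bar>h x\<bar> \<le> B" "\<And>x. x \<notin> {- pi..<pi} \<Longrightarrow> h x = 0"
  shows "has_bochner_integral lborel (\<lambda>x. h x *\<^sub>R exp (- \<i> * complex_of_real (of_int n * x)))
           (complex_of_real (2 * pi) * fourier_coeff h n)"
proof -
  have "integrable lborel (\<lambda>x. h x *\<^sub>R exp (- \<i> * complex_of_real (of_int n * x)))"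
    by (rule integrable_bounded_support[of "{- pi..<pi}" _ B]) (use h in auto)
  then show ?thesis by (simp add: has_bochner_integral_iff fourier_coeff_def)
qed

lemma fourier_coeff_uminus: "fourier_coeff h (- n) = cnj (fourier_coeff h n)"
  using Bochner_Integration.integral_cnj[of lborel "\<lambda>x. h x *\<^sub>R exp (- \<i> * complex_of_real (of_int n * x))"]
  by (simp add: fourier_coeff_def exp_cnj)

text \<open>Orthogonality of the exponentials over one period. It serves both Bessel's inequality
  and the coordinates in which a set is unrestricted.\<close>

lemma fourier_coeff_period:
  "fourier_coeff (indicator {- pi..<pi}) n = (if n = 0 then 1 else 0)"
proof -
  \<comment> \<open>Adding the null set of the right end point yields a closed interval, as the
    fundamental theorem of calculus requires.\<close>
  have "set_lebesgue_integral lborel {- pi..<pi} (\<lambda>x. exp (- \<i> * complex_of_real (of_int n * x)))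
      = set_lebesgue_integral lborel {- pi..pi} (\<lambda>x. exp (- \<i> * complex_of_real (of_int n * x)))"
    unfolding set_lebesgue_integral_def
    by (rule integral_discrete_difference[of "{pi}"]) (auto split: split_indicator)
  also have "\<dots> = (if n = 0 then 2 * pi else 0)"
  proof (cases "n = 0")
    case True
    then show ?thesis by (simp add: set_lebesgue_integral_def scaleR_conv_of_real)
  next
    case False
    define F where "F z = exp (- \<i> * of_int n * z) / (- \<i> * of_int n)" for z :: complex
    have "set_lebesgue_integral lborel {- pi..pi} (\<lambda>x. exp (- \<i> * complex_of_real (of_int n * x)))
       = F (of_real pi) - F (of_real (- pi))"
      unfolding set_lebesgue_integral_def
    proof (rule integral_FTC_Icc)
      fix x
      have "(F has_field_derivative exp (- \<i> * complex_of_real (of_int n * x))) (at (of_real x))"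
        unfolding F_def using False by (auto intro!: derivative_eq_intros simp: mult.assoc)
      then show "((\<lambda>x. F (of_real x)) has_vector_derivative exp (- \<i> * complex_of_real (of_int n * x)))
             (at x within {- pi..pi})"
        by (rule has_vector_derivative_real_field)
    qed (auto intro!: continuous_intros)
    also have "F (of_real pi) - F (of_real (- pi)) = 0"
    proof -
      \<comment> \<open>The two exponents differ by 2 pi i n.\<close>
      have "exp (- \<i> * of_int n * complex_of_real (- pi)) = exp (- \<i> * of_int n * complex_of_real pi)"
        by (rule iffD2[OF exp_eq], rule exI[of _ n]) (simp add: algebra_simps)
      then show ?thesis by (simp add: F_def)
    qed
    finally show ?thesis using False by simp
  qed
  finally show ?thesis by (auto simp: fourier_coeff_def set_lebesgue_integral_def)
qed

text \<open>Expand the nonnegative integral of the squared distance between \<open>h\<close> and its partial Fourier sum.\<close>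
lemma bessel_inequality:
  assumes h: "h \<in> borel_measurable borel" "\<And>x. \<bar>h x\<bar> \<le> B" "\<And>x. x \<notin> {- pi..<pi} \<Longrightarrow> h x = 0"
    and S: "finite S"
  shows "2 * pi * (\<Sum>n\<in>S. (cmod (fourier_coeff h n))\<^sup>2) \<le> (\<integral>x. (h x)\<^sup>2 \<partial>lborel)"
proof -
  define e where "e n x = exp (- \<i> * complex_of_real (of_int n * x))" for n :: int and x :: real
  define c where "c = fourier_coeff h"
  define p where "p x = (\<Sum>n\<in>S. c n * e (- n) x)" for x
  let ?E = "{- pi..<pi}"
  let ?s = "\<Sum>n\<in>S. (cmod (c n))\<^sup>2"
  have e_mult: "e n x * e m x = e (n + m) x" for n m x
    by (simp add: e_def exp_add[symmetric] algebra_simps)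
  have e_cnj: "cnj (e n x) = e (- n) x" for n x
    by (simp add: e_def exp_cnj)
  have hI: "has_bochner_integral lborel (\<lambda>x. complex_of_real (h x) * e n x) (complex_of_real (2 * pi) * c n)" for n
    using has_integral_fourier_coeff[OF h, of n] by (simp add: e_def c_def scaleR_conv_of_real)
  have cnjc: "c (- n) = cnj (c n)" for n by (simp add: c_def fourier_coeff_uminus)
  have EI: "has_bochner_integral lborel (\<lambda>x. complex_of_real (indicator ?E x) * e n x)
      (complex_of_real (2 * pi) * (if n = 0 then 1 else 0))" for n
    using has_integral_fourier_coeff[of "indicator ?E" 1 n]
    by (simp add: e_def scaleR_conv_of_real fourier_coeff_period[symmetric])
  have h2: "integrable lborel (\<lambda>x. (h x)\<^sup>2)"
  proof (rule integrable_bounded_support[of ?E _ "B\<^sup>2"])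
    show "norm ((h x)\<^sup>2) \<le> B\<^sup>2" for x
      using h(2)[of x] by (simp add: abs_le_square_iff[symmetric])
  qed (use h in auto)
  have "has_bochner_integral lborel (\<lambda>x. complex_of_real ((h x)\<^sup>2)
       - (\<Sum>n\<in>S. cnj (c n) * (complex_of_real (h x) * e n x))
       - (\<Sum>n\<in>S. c n * (complex_of_real (h x) * e (- n) x))
       + (\<Sum>n\<in>S. \<Sum>m\<in>S. c n * cnj (c m) * (complex_of_real (indicator ?E x) * e (m - n) x)))
     (complex_of_real (\<integral>x. (h x)\<^sup>2 \<partial>lborel)
       - (\<Sum>n\<in>S. cnj (c n) * (complex_of_real (2 * pi) * c n))
       - (\<Sum>n\<in>S. c n * (complex_of_real (2 * pi) * c (- n)))
       + (\<Sum>n\<in>S. \<Sum>m\<in>S. c n * cnj (c m) * (complex_of_real (2 * pi) * (if m - n = 0 then 1 else 0))))"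
    using h2
    by (intro has_bochner_integral_add has_bochner_integral_diff has_bochner_integral_sum
          has_bochner_integral_mult_right hI EI has_bochner_integral_of_real)
       (auto intro: has_bochner_integral_integrable)
  also have "(\<lambda>x. complex_of_real ((h x)\<^sup>2)
       - (\<Sum>n\<in>S. cnj (c n) * (complex_of_real (h x) * e n x))
       - (\<Sum>n\<in>S. c n * (complex_of_real (h x) * e (- n) x))
       + (\<Sum>n\<in>S. \<Sum>m\<in>S. c n * cnj (c m) * (complex_of_real (indicator ?E x) * e (m - n) x)))
     = (\<lambda>x. complex_of_real (indicator ?E x * (cmod (complex_of_real (h x) - p x))\<^sup>2))"
  proof
    fix x
    have cp: "cnj (p x) = (\<Sum>m\<in>S. cnj (c m) * e m x)" by (simp add: p_def e_cnj)
    have pp: "p x * cnj (p x) = (\<Sum>n\<in>S. \<Sum>m\<in>S. c n * cnj (c m) * e (m - n) x)"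
      unfolding cp unfolding p_def sum_product
      by (intro sum.cong refl) (simp add: mult.assoc mult.left_commute[of "e _ x"] e_mult)
    have "complex_of_real (indicator ?E x * (cmod (complex_of_real (h x) - p x))\<^sup>2)
      = indicator ?E x * ((complex_of_real (h x) - p x) * cnj (complex_of_real (h x) - p x))"
      by (simp only: of_real_mult complex_norm_square of_real_indicator)
    also have "\<dots> = complex_of_real ((h x)\<^sup>2) - complex_of_real (h x) * cnj (p x)
       - complex_of_real (h x) * p x + indicator ?E x * (p x * cnj (p x))"
      \<comment> \<open>Since \<open>h\<close> vanishes off \<open>?E\<close>, the indicator
        disappears from every term containing \<open>h\<close> and survives only in front of |p|^2,
        where it makes \<open>EI\<close> applicable.\<close>
      using h(3)[of x] by (cases "x \<in> ?E") (auto simp: algebra_simps power2_eq_square)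
    also have "\<dots> = complex_of_real ((h x)\<^sup>2)
       - (\<Sum>n\<in>S. cnj (c n) * (complex_of_real (h x) * e n x))
       - (\<Sum>n\<in>S. c n * (complex_of_real (h x) * e (- n) x))
       + (\<Sum>n\<in>S. \<Sum>m\<in>S. c n * cnj (c m) * (complex_of_real (indicator ?E x) * e (m - n) x))"
      unfolding pp unfolding cp unfolding p_def
      by (simp add: sum_distrib_left mult_ac of_real_indicator)
    finally show "complex_of_real ((h x)\<^sup>2)
       - (\<Sum>n\<in>S. cnj (c n) * (complex_of_real (h x) * e n x))
       - (\<Sum>n\<in>S. c n * (complex_of_real (h x) * e (- n) x))
       + (\<Sum>n\<in>S. \<Sum>m\<in>S. c n * cnj (c m) * (complex_of_real (indicator ?E x) * e (m - n) x))
      = complex_of_real (indicator ?E x * (cmod (complex_of_real (h x) - p x))\<^sup>2)" by simp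
  qed
  also have "complex_of_real (\<integral>x. (h x)\<^sup>2 \<partial>lborel)
       - (\<Sum>n\<in>S. cnj (c n) * (complex_of_real (2 * pi) * c n))
       - (\<Sum>n\<in>S. c n * (complex_of_real (2 * pi) * c (- n)))
       + (\<Sum>n\<in>S. \<Sum>m\<in>S. c n * cnj (c m) * (complex_of_real (2 * pi) * (if m - n = 0 then 1 else 0)))
     = complex_of_real ((\<integral>x. (h x)\<^sup>2 \<partial>lborel) - 2 * pi * ?s)"
  proof -
    have "(\<Sum>n\<in>S. \<Sum>m\<in>S. c n * cnj (c m) * (complex_of_real (2 * pi) * (if m - n = 0 then 1 else 0)))
      = (\<Sum>n\<in>S. \<Sum>m\<in>S. if m = n then c n * cnj (c n) * complex_of_real (2 * pi) else 0)"
      by (intro sum.cong refl) auto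
    also have "\<dots> = complex_of_real (2 * pi * ?s)"
      using S by (simp add: sum_distrib_left complex_norm_square mult_ac del: of_real_power)
    finally have 1: "(\<Sum>n\<in>S. \<Sum>m\<in>S. c n * cnj (c m) * (complex_of_real (2 * pi) * (if m - n = 0 then 1 else 0)))
      = complex_of_real (2 * pi * ?s)" .
    have 2: "(\<Sum>n\<in>S. cnj (c n) * (complex_of_real (2 * pi) * c n)) = complex_of_real (2 * pi * ?s)"
      by (simp add: sum_distrib_left complex_norm_square mult_ac del: of_real_power)
    have 3: "(\<Sum>n\<in>S. c n * (complex_of_real (2 * pi) * c (- n))) = complex_of_real (2 * pi * ?s)"
      by (simp add: cnjc sum_distrib_left complex_norm_square mult_ac del: of_real_power)
    \<comment> \<open>The two mixed terms and the square of \<open>p\<close> all equal 2 pi times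
      \<open>?s\<close>. They carry the signs -, -, +, so one copy is subtracted in the end.\<close>
    show ?thesis unfolding 1 2 3 by simp
  qed
  finally have "has_bochner_integral lborel
      (\<lambda>x. indicator ?E x * (cmod (complex_of_real (h x) - p x))\<^sup>2)
      ((\<integral>x. (h x)\<^sup>2 \<partial>lborel) - 2 * pi * ?s)"
    by (auto dest: has_bochner_integral_bounded_linear[OF bounded_linear_Re])
  then have "(\<integral>x. indicator ?E x * (cmod (complex_of_real (h x) - p x))\<^sup>2 \<partial>lborel)
     = (\<integral>x. (h x)\<^sup>2 \<partial>lborel) - 2 * pi * ?s" by (simp add: has_bochner_integral_iff)
  moreover have "(\<integral>x. indicator ?E x * (cmod (complex_of_real (h x) - p x))\<^sup>2 \<partial>lborel) \<ge> 0"
    by (intro integral_nonneg_AE) auto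
  ultimately show ?thesis by (simp add: c_def)
qed

section \<open>Low Fourier coefficients of square waves\<close>

definition square_wave :: "real \<Rightarrow> real \<Rightarrow> real" where
  "square_wave h x = (if even \<lfloor>x / h\<rfloor> then 1 else - 1)"

lemma square_wave_shift: "h > 0 \<Longrightarrow> square_wave h (x + h) = - square_wave h x"
  by (simp add: square_wave_def add_divide_distrib)

lemma square_wave_measurable [measurable]: "square_wave h \<in> borel_measurable borel"
  unfolding square_wave_def by measurable

lemma abs_square_wave [simp]: "\<bar>square_wave h x\<bar> = 1"
  by (simp add: square_wave_def)

text \<open>After a rotation one of the points is 1, and the chord 2 |sin((t - s) / 2)| is at most
  the arc.\<close>

lemma norm_exp_i_diff_le: "cmod (exp (- \<i> * complex_of_real s) - exp (- \<i> * complex_of_real t)) \<le> \<bar>s - t\<bar>"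
proof -
  have "exp (- \<i> * complex_of_real s) - exp (- \<i> * complex_of_real t)
     = exp (- \<i> * complex_of_real t) * (exp (\<i> * complex_of_real (t - s)) - 1)"
    by (simp add: algebra_simps exp_add[symmetric])
  then have "cmod (exp (- \<i> * complex_of_real s) - exp (- \<i> * complex_of_real t))
     = cmod (exp (\<i> * complex_of_real (t - s)) - 1)"
    by (simp add: norm_mult)
  also have "\<dots> = 2 * \<bar>sin ((t - s) / 2)\<bar>"
    using dist_exp_i_1[of "t - s"] by (simp add: dist_norm)
  also have "\<dots> \<le> \<bar>s - t\<bar>"
    using abs_sin_x_le_abs_x[of "(t - s) / 2"] by simp
  finally show ?thesis .
qed

text \<open>Shifting by half a period flips the sign of the wave, so the integral equals half the
  integral of a difference that is small except near the two end points.\<close>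
lemma square_wave_integral_bound:
  assumes h: "h > 0" and ab: "a \<le> b"
  shows "cmod (\<integral>x. (indicator {a..<b} x * square_wave h x) *\<^sub>R
             exp (- \<i> * complex_of_real (of_int n * x)) \<partial>lborel)
       \<le> ((b - a) * \<bar>of_int n\<bar> * h + 2 * h) / 2"
proof -
  define e where "e x = exp (- \<i> * complex_of_real (of_int n * x))" for x :: real
  define \<phi> where "\<phi> x = (indicator {a..<b} x * square_wave h x) *\<^sub>R e x" for x
  \<comment> \<open>The first summand bounds the change of the exponential when \<open>x\<close> and
    \<open>x + h\<close> both lie in the interval. The other two cover the points for which exactly
    one of them does, near \<open>a\<close> and near \<open>b\<close> respectively.\<close>
  define g where "g x = indicator {a..<b} x * (\<bar>of_int n\<bar> * h) + indicator {a-h..<a} x + indicator {b-h..<b} x" for x :: real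
  have [measurable]: "e \<in> borel_measurable borel" unfolding e_def by measurable
  have int: "integrable lborel \<phi>"
    by (rule integrable_bounded_support[of "{a..<b}" _ 1])
       (use ab in \<open>auto simp: \<phi>_def[abs_def] e_def abs_mult split: split_indicator\<close>)
  have shift: "integrable lborel (\<lambda>x. \<phi> (x + h))" "(\<integral>x. \<phi> (x + h) \<partial>lborel) = (\<integral>x. \<phi> x \<partial>lborel)"
    using lborel_integrable_real_affine[OF int, of 1 h] lborel_integral_real_affine[of 1 \<phi> h]
    by (simp_all add: add.commute)
  have "2 * (\<integral>x. \<phi> x \<partial>lborel) = (\<integral>x. \<phi> x + \<phi> (x + h) \<partial>lborel)"
    using int shift by simp
  then have "2 * cmod (\<integral>x. \<phi> x \<partial>lborel) = cmod (\<integral>x. \<phi> x + \<phi> (x + h) \<partial>lborel)"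
    by (metis norm_mult norm_numeral)
  also have "\<dots> \<le> (\<integral>x. g x \<partial>lborel)"
  proof (rule Bochner_Integration.integral_norm_bound_integral)
    show "integrable lborel (\<lambda>x. \<phi> x + \<phi> (x + h))" using int shift by simp
    show "integrable lborel g" unfolding g_def using h ab
      by (intro Bochner_Integration.integrable_add integrable_mult_left integrable_real_indicator) auto
    fix x
    have e1: "cmod (e x) = 1" for x by (simp add: e_def)
    have "cmod (e x - e (x + h)) \<le> \<bar>of_int n * x - of_int n * (x + h)\<bar>"
      unfolding e_def by (rule norm_exp_i_diff_le)
    also have "\<dots> = \<bar>of_int n\<bar> * h" using h by (simp add: algebra_simps abs_mult)
    finally have d: "cmod (e x - e (x + h)) \<le> \<bar>of_int n\<bar> * h" .
    have "\<phi> x + \<phi> (x + h) = square_wave h x *\<^sub>R (indicator {a..<b} x *\<^sub>R e x - indicator {a..<b} (x + h) *\<^sub>R e (x + h))"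
      by (simp add: \<phi>_def square_wave_shift[OF h] scaleR_diff_right mult.commute)
    then have "cmod (\<phi> x + \<phi> (x + h)) = cmod (indicator {a..<b} x *\<^sub>R e x - indicator {a..<b} (x + h) *\<^sub>R e (x + h))"
      by simp
    also have "\<dots> \<le> g x"
      using d e1[of x] e1[of "x + h"] h by (auto simp: g_def indicator_def)
    finally show "norm (\<phi> x + \<phi> (x + h)) \<le> g x" .
  qed
  also have "\<dots> = (b - a) * \<bar>of_int n\<bar> * h + 2 * h"
    unfolding g_def using h ab by simp
  finally show ?thesis by (simp add: \<phi>_def e_def)
qed

subsection \<open>The symbol of a product set\<close>

lemma prod_Basis_vec:
  "(\<Prod>b\<in>(Basis :: (real^'d::finite) set). g b) = (\<Prod>i\<in>UNIV. g (axis i 1))"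
proof -
  have B: "(Basis :: (real^'d) set) = range (\<lambda>i. axis i 1)"
    by (auto simp: Basis_vec_def)
  have inj: "inj (\<lambda>i::'d. axis i (1::real))"
    by (auto simp: inj_def axis_eq_axis)
  show ?thesis unfolding B prod.reindex[OF inj] by simp
qed

text \<open>Fubini: Lebesgue measure is the image of the product of one-dimensional Lebesgue
  measures over \<open>Basis\<close>.\<close>

lemma integral_lborel_prod:
  fixes g :: "'a::euclidean_space \<Rightarrow> real \<Rightarrow> complex"
  assumes int: "\<And>b. b \<in> Basis \<Longrightarrow> integrable lborel (g b)"
  shows "(\<integral>x. (\<Prod>b\<in>Basis. g b (x \<bullet> b)) \<partial>(lborel :: 'a measure)) = (\<Prod>b\<in>Basis. \<integral>x. g b x \<partial>lborel)"
proof -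
  interpret product_sigma_finite "\<lambda>_::'a. lborel :: real measure" ..
  have [measurable]: "g b \<in> borel_measurable borel" if "b \<in> Basis" for b
    using borel_measurable_integrable[OF int[OF that]] by simp
  have "(\<integral>x. (\<Prod>b\<in>Basis. g b (x \<bullet> b)) \<partial>(lborel :: 'a measure))
      = (\<integral>f. (\<Prod>b\<in>Basis. g b ((\<Sum>b\<in>Basis. f b *\<^sub>R b) \<bullet> b)) \<partial>(\<Pi>\<^sub>M b\<in>(Basis::'a set). lborel))"
    by (subst lborel_eq, subst integral_distr) measurable
  also have "\<dots> = (\<integral>f. (\<Prod>b\<in>Basis. g b (f b)) \<partial>(\<Pi>\<^sub>M b\<in>(Basis::'a set). lborel))"
    by (intro Bochner_Integration.integral_cong refl prod.cong)
       (simp add: inner_sum_left inner_Basis if_distrib cong: if_cong)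
  also have "\<dots> = (\<Prod>b\<in>Basis. \<integral>x. g b x \<partial>lborel)"
    by (rule product_integral_prod) (auto intro: int)
  finally show ?thesis .
qed

lemma integral_lborel_prod_vec:
  fixes g :: "'d::finite \<Rightarrow> real \<Rightarrow> complex"
  assumes int: "\<And>i. integrable lborel (g i)"
  shows "(\<integral>x. (\<Prod>i\<in>UNIV. g i (x $ i)) \<partial>(lborel :: (real^'d) measure)) = (\<Prod>i\<in>UNIV. \<integral>x. g i x \<partial>lborel)"
proof -
  \<comment> \<open>\<open>G\<close> recovers the coordinate index from the basis vector, to pass
    from products over \<open>Basis\<close> to products over indices.\<close>
  define G where "G b = g (SOME i. b = axis i 1)" for b :: "real^'d"
  have G: "G (axis i 1) = g i" for i by (simp add: G_def axis_eq_axis)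
  have "(\<integral>x. (\<Prod>b\<in>Basis. G b (x \<bullet> b)) \<partial>(lborel :: (real^'d) measure)) = (\<Prod>b\<in>Basis. \<integral>x. G b x \<partial>lborel)"
    by (rule integral_lborel_prod) (auto simp: G_def int)
  then show ?thesis by (simp add: prod_Basis_vec G inner_axis)
qed

lemma symbolQ_lborel:
  fixes M :: "(real^'d::finite) set"
  assumes [measurable]: "M \<in> sets borel"
  shows "symbolQ M k l = complex_of_real (1 / (2 * pi) ^ CARD('d)) *
     integral\<^sup>L lborel (\<lambda>a. indicator M a *\<^sub>R
        exp (- \<i> * complex_of_real (\<Sum>i\<in>UNIV. real_of_int (l i - k i) * a $ i)))"
  unfolding symbolQ_def by (subst integral_completion) auto

text \<open>The exponential and the indicator both factor over the coordinates, and the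
  normalization supplies one factor 1 / (2 pi) to each one-dimensional integral.\<close>

lemma symbolQ_product_set:
  fixes B :: "'d::finite \<Rightarrow> real set"
  assumes B: "\<And>i. B i \<in> sets borel" "\<And>i. B i \<subseteq> {- pi..<pi}"
  shows "symbolQ {a. \<forall>i. a $ i \<in> B i} k l = (\<Prod>i\<in>UNIV. fourier_coeff (indicator (B i)) (l i - k i))"
proof -
  let ?M = "{a::real^'d. \<forall>i. a $ i \<in> B i}"
  let ?g = "\<lambda>i x. indicator (B i) x *\<^sub>R exp (- \<i> * complex_of_real (of_int (l i - k i) * x))"
  have int: "has_bochner_integral lborel (?g i)
      (complex_of_real (2 * pi) * fourier_coeff (indicator (B i)) (l i - k i))" for i
  proof (rule has_integral_fourier_coeff[of _ 1])
    show "indicator (B i) x = (0::real)" if "x \<notin> {- pi..<pi}" for x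
      using that B(2)[of i] by (auto simp: indicator_def)
  qed (use B(1) in \<open>auto split: split_indicator\<close>)
  have [measurable]: "B i \<in> sets borel" for i by (rule B)
  have M: "?M \<in> sets borel"
    by measurable
  have "(\<lambda>a. indicator ?M a *\<^sub>R exp (- \<i> * complex_of_real (\<Sum>i\<in>UNIV. real_of_int (l i - k i) * a $ i)))
     = (\<lambda>a. \<Prod>i\<in>UNIV. ?g i (a $ i))"
  proof
    fix a :: "real^'d"
    have "exp (- \<i> * complex_of_real (\<Sum>i\<in>UNIV. real_of_int (l i - k i) * a $ i))
       = (\<Prod>i\<in>UNIV. exp (- \<i> * complex_of_real (of_int (l i - k i) * a $ i)))"
      by (simp add: exp_sum[symmetric] sum_distrib_left sum_negf)
    moreover have "indicator ?M a = (\<Prod>i\<in>UNIV. indicator (B i) (a $ i) :: real)"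
      by (auto simp: indicator_def)
    ultimately show "indicator ?M a *\<^sub>R exp (- \<i> * complex_of_real (\<Sum>i\<in>UNIV. real_of_int (l i - k i) * a $ i))
      = (\<Prod>i\<in>UNIV. ?g i (a $ i))"
      by (simp add: scaleR_conv_of_real prod.distrib)
  qed
  then have "symbolQ ?M k l = complex_of_real (1 / (2 * pi) ^ CARD('d)) *
      (\<integral>a. (\<Prod>i\<in>UNIV. ?g i (a $ i)) \<partial>(lborel :: (real^'d) measure))"
    unfolding symbolQ_lborel[OF M] by simp
  also have "(\<integral>a. (\<Prod>i\<in>UNIV. ?g i (a $ i)) \<partial>(lborel :: (real^'d) measure)) = (\<Prod>i\<in>UNIV. \<integral>x. ?g i x \<partial>lborel)"
    by (rule integral_lborel_prod_vec) (use int in \<open>auto simp: has_bochner_integral_iff\<close>)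
  also have "\<dots> = (\<Prod>i\<in>UNIV. complex_of_real (2 * pi) * fourier_coeff (indicator (B i)) (l i - k i))"
    using int by (simp add: has_bochner_integral_iff)
  also have "\<dots> = complex_of_real ((2 * pi) ^ CARD('d)) * (\<Prod>i\<in>UNIV. fourier_coeff (indicator (B i)) (l i - k i))"
    by (simp add: prod.distrib power_mult_distrib)
  finally show ?thesis by simp
qed

section \<open>The symbol as a quadratic form between 0 and 1\<close>

lemma torus_box_alt: "torus_box = {a. \<forall>i. a $ i \<in> {- pi..<pi}}"
  by (auto simp: torus_box_def)

lemma borel_torus_box: "(torus_box :: (real^'d::finite) set) \<in> sets borel"
  unfolding torus_box_alt by measurable

lemma emeasure_torus_box: "emeasure lborel (torus_box :: (real^'d::finite) set) < \<infinity>"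
proof -
  have "(torus_box :: (real^'d) set) \<subseteq> cbox (\<chi> i. - pi) (\<chi> i. pi)"
    by (auto simp: torus_box_def mem_box_cart less_imp_le)
  then have "emeasure lborel (torus_box :: (real^'d) set) \<le> emeasure lborel (cbox (\<chi> i. - pi) (\<chi> i. pi) :: (real^'d) set)"
    by (intro emeasure_mono) auto
  also have "\<dots> < \<infinity>" by (rule emeasure_lborel_cbox_finite)
  finally show ?thesis .
qed

text \<open>The full torus yields the identity matrix, the reference point for the upper bound Q <=
  1.\<close>

lemma symbolQ_torus_box:
  fixes k l :: "'d::finite \<Rightarrow> int"
  shows "symbolQ torus_box k l = (if k = l then 1 else 0)"
  unfolding torus_box_alt
  by (subst symbolQ_product_set) (auto simp: fourier_coeff_period fun_eq_iff, metis)

lemma has_integral_symbolQ: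
  fixes M :: "(real^'d::finite) set"
  assumes M: "M \<in> sets borel" "M \<subseteq> torus_box"
  shows "has_bochner_integral lborel (\<lambda>a. indicator M a *\<^sub>R
        exp (- \<i> * complex_of_real (\<Sum>i\<in>UNIV. real_of_int (l i - k i) * a $ i)))
     (complex_of_real ((2 * pi) ^ CARD('d)) * symbolQ M k l)"
proof -
  have "integrable lborel (\<lambda>a. indicator M a *\<^sub>R
        exp (- \<i> * complex_of_real (\<Sum>i\<in>UNIV. real_of_int (l i - k i) * a $ i)))"
  proof (rule integrable_bounded_support[OF borel_torus_box emeasure_torus_box, of _ 1])
    show "(\<lambda>a. indicator M a *\<^sub>R
        exp (- \<i> * complex_of_real (\<Sum>i\<in>UNIV. real_of_int (l i - k i) * a $ i))) \<in> borel_measurable borel"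
      using M(1) by measurable
  qed (use M in \<open>auto split: split_indicator\<close>)
  then show ?thesis by (simp add: has_bochner_integral_iff symbolQ_lborel[OF M(1)])
qed

text \<open>With the sums taken inside the integral, the form becomes the integral over
  \<open>M\<close> of |P|^2, where P is the trigonometric polynomial with coefficients
  \<open>u\<close>. This integrand is real, whence the second claim.\<close>

lemma symbolQ_quadratic_form:
  fixes M :: "(real^'d::finite) set"
  assumes M: "M \<in> sets borel" "M \<subseteq> torus_box"
  shows "has_bochner_integral lborel
      (\<lambda>a. indicator M a * (cmod (\<Sum>l\<in>S. u l * exp (- \<i> * complex_of_real (\<Sum>i\<in>UNIV. real_of_int (l i) * a $ i))))\<^sup>2)
      ((2 * pi) ^ CARD('d) * Re (\<Sum>k\<in>S. \<Sum>l\<in>S. cnj (u k) * symbolQ M k l * u l))"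
    and "Im (\<Sum>k\<in>S. \<Sum>l\<in>S. cnj (u k) * symbolQ M k l * u l) = 0"
proof -
  define e where "e k a = exp (- \<i> * complex_of_real (\<Sum>i\<in>UNIV. real_of_int (k i) * a $ i))"
    for k :: "'d \<Rightarrow> int" and a :: "real^'d"
  let ?P = "\<lambda>a. \<Sum>l\<in>S. u l * e l a"
  let ?q = "\<Sum>k\<in>S. \<Sum>l\<in>S. cnj (u k) * symbolQ M k l * u l"
  have "has_bochner_integral lborel
     (\<lambda>a. \<Sum>k\<in>S. \<Sum>l\<in>S. cnj (u k) * u l * (indicator M a *\<^sub>R
        exp (- \<i> * complex_of_real (\<Sum>i\<in>UNIV. real_of_int (l i - k i) * a $ i))))
     (\<Sum>k\<in>S. \<Sum>l\<in>S. cnj (u k) * u l * (complex_of_real ((2 * pi) ^ CARD('d)) * symbolQ M k l))"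
    by (intro has_bochner_integral_sum has_bochner_integral_mult_right has_integral_symbolQ[OF M])
  also have "(\<lambda>a. \<Sum>k\<in>S. \<Sum>l\<in>S. cnj (u k) * u l * (indicator M a *\<^sub>R
        exp (- \<i> * complex_of_real (\<Sum>i\<in>UNIV. real_of_int (l i - k i) * a $ i))))
     = (\<lambda>a. complex_of_real (indicator M a * (cmod (?P a))\<^sup>2))"
  proof
    fix a
    have e: "exp (- \<i> * complex_of_real (\<Sum>i\<in>UNIV. real_of_int (l i - k i) * a $ i)) = e l a * cnj (e k a)"
      for k l :: "'d \<Rightarrow> int"
      by (simp add: e_def exp_cnj exp_add[symmetric] algebra_simps sum_subtractf)
    have "(\<Sum>k\<in>S. \<Sum>l\<in>S. cnj (u k) * u l * (indicator M a *\<^sub>R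
        exp (- \<i> * complex_of_real (\<Sum>i\<in>UNIV. real_of_int (l i - k i) * a $ i))))
      = complex_of_real (indicator M a) * (cnj (?P a) * ?P a)"
    proof -
      have "cnj (?P a) * ?P a = (\<Sum>k\<in>S. \<Sum>l\<in>S. (cnj (u k) * cnj (e k a)) * (u l * e l a))"
        by (simp add: sum_product)
      then show ?thesis
        unfolding e by (simp add: sum_distrib_left scaleR_conv_of_real mult_ac)
    qed
    also have "cnj (?P a) * ?P a = complex_of_real ((cmod (?P a))\<^sup>2)"
      by (subst complex_norm_square) (simp add: mult.commute)
    finally show "(\<Sum>k\<in>S. \<Sum>l\<in>S. cnj (u k) * u l * (indicator M a *\<^sub>R
        exp (- \<i> * complex_of_real (\<Sum>i\<in>UNIV. real_of_int (l i - k i) * a $ i))))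
      = complex_of_real (indicator M a * (cmod (?P a))\<^sup>2)" by simp
  qed
  also have "(\<Sum>k\<in>S. \<Sum>l\<in>S. cnj (u k) * u l * (complex_of_real ((2 * pi) ^ CARD('d)) * symbolQ M k l))
     = complex_of_real ((2 * pi) ^ CARD('d)) * ?q"
    unfolding sum_distrib_left by (intro sum.cong refl) (simp add: mult_ac)
  finally have I: "has_bochner_integral lborel (\<lambda>a. complex_of_real (indicator M a * (cmod (?P a))\<^sup>2))
     (complex_of_real ((2 * pi) ^ CARD('d)) * ?q)" .
  from has_bochner_integral_bounded_linear[OF bounded_linear_Re this]
  show "has_bochner_integral lborel
      (\<lambda>a. indicator M a * (cmod (\<Sum>l\<in>S. u l * exp (- \<i> * complex_of_real (\<Sum>i\<in>UNIV. real_of_int (l i) * a $ i))))\<^sup>2)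
      ((2 * pi) ^ CARD('d) * Re ?q)"
    by (simp only: Re_complex_of_real Im_complex_of_real times_complex.sel mult_zero_left diff_zero e_def)
  from has_bochner_integral_bounded_linear[OF bounded_linear_Im I]
  have "has_bochner_integral (lborel :: (real^'d) measure) (\<lambda>a. 0) ((2 * pi) ^ CARD('d) * Im ?q)"
    by (simp only: Re_complex_of_real Im_complex_of_real times_complex.sel mult_zero_left add_0_right)
  from has_bochner_integral_eq[OF this has_bochner_integral_zero]
  show "Im ?q = 0" by simp
qed

text \<open>The integral of |P|^2 over \<open>M\<close> is nonnegative and at most that over the
  whole torus, which is (2 pi)^d |u|^2 by \<open>symbolQ_torus_box\<close>. This supplies the
  assumption \<open>form\<close> of \<open>entropy_char_sum_ge\<close>.\<close>

lemma symbolQ_form_bounds: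
  fixes M :: "(real^'d::finite) set" and S :: "('d \<Rightarrow> int) set"
  assumes M: "M \<in> sets borel" "M \<subseteq> torus_box" and S: "finite S"
  shows "\<exists>r. (\<Sum>k\<in>S. \<Sum>l\<in>S. cnj (u k) * symbolQ M k l * u l) = complex_of_real r \<and>
           0 \<le> r \<and> r \<le> (\<Sum>k\<in>S. (cmod (u k))\<^sup>2)"
proof -
  let ?q = "\<lambda>M. \<Sum>k\<in>S. \<Sum>l\<in>S. cnj (u k) * symbolQ M k l * u l"
  let ?P = "\<lambda>a. (cmod (\<Sum>l\<in>S. u l * exp (- \<i> * complex_of_real (\<Sum>i\<in>UNIV. real_of_int (l i) * a $ i))))\<^sup>2"
  note I = symbolQ_quadratic_form(1)[OF M, where S = S and u = u, unfolded has_bochner_integral_iff]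
  note J = symbolQ_quadratic_form(1)[OF borel_torus_box order.refl, where S = S and u = u, unfolded has_bochner_integral_iff]
  have pos: "0 < (2 * pi) ^ CARD('d)" by simp
  have "(2 * pi) ^ CARD('d) * 0 \<le> (2 * pi) ^ CARD('d) * Re (?q M)"
    unfolding I[THEN conjunct2, symmetric] mult_zero_right by (intro integral_nonneg_AE) auto
  then have 0: "0 \<le> Re (?q M)" by (rule mult_left_le_imp_le[OF _ pos])
  have "(2 * pi) ^ CARD('d) * Re (?q M) \<le> (2 * pi) ^ CARD('d) * Re (?q torus_box)"
    unfolding I[THEN conjunct2, symmetric] J[THEN conjunct2, symmetric]
  proof (rule integral_mono)
    show "indicator M a * ?P a \<le> indicator torus_box a * ?P a" for a
      using M(2) by (auto split: split_indicator)
  qed (use I J in auto)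
  then have "Re (?q M) \<le> Re (?q torus_box)" by (rule mult_left_le_imp_le[OF _ pos])
  also have "?q torus_box = (\<Sum>k\<in>S. \<Sum>l\<in>S. if l = k then cnj (u k) * u k else 0)"
    by (intro sum.cong refl) (auto simp: symbolQ_torus_box)
  also have "\<dots> = complex_of_real (\<Sum>k\<in>S. (cmod (u k))\<^sup>2)"
    using S by (simp add: complex_norm_square mult.commute del: of_real_power)
  finally have "Re (?q M) \<le> (\<Sum>k\<in>S. (cmod (u k))\<^sup>2)" by simp
  moreover have "?q M = complex_of_real (Re (?q M))"
    using symbolQ_quadratic_form(2)[OF M, where S = S and u = u] by (simp add: complex_eq_iff)
  ultimately show ?thesis using 0 by blast
qed

subsection \<open>Entropy of striped sets\<close>

text \<open>Apply Bessel's inequality to the indicator minus a quarter of the wave: this hardly changes the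
  low Fourier coefficients, but lowers the \<open>L\<^sup>2\<close> norm by an amount proportional to \<open>b - a\<close>.\<close>
lemma fourier_tail_ge:
  fixes a b h :: real and L :: nat
  assumes A: "A \<in> sets borel" "A \<subseteq> {- pi..<pi}"
    and ab: "a < b" "{a..<b} \<subseteq> {- pi..<pi}" and h: "h > 0"
    and Ah: "\<And>x. x \<in> {a..<b} \<Longrightarrow> x \<in> A \<longleftrightarrow> even \<lfloor>x / h\<rfloor>"
    and hL: "((b - a) * L * h + 2 * h) * (2 * L + 1) \<le> b - a"
    and S: "finite S" "card S \<le> L" "\<And>n. n \<in> S \<Longrightarrow> \<bar>n\<bar> \<le> int L"
  shows "Re (fourier_coeff (indicator A) 0) - (\<Sum>n\<in>S. (cmod (fourier_coeff (indicator A) n))\<^sup>2) \<ge> (b - a) / (32 * pi)"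
proof -
  let ?I = "{a..<b}"
  define f :: "real \<Rightarrow> real" where "f = indicator A"
  define w where "w x = indicator ?I x * square_wave h x" for x
  define g where "g x = f x - 1 / 4 * w x" for x
  \<comment> \<open>The bound of \<open>square_wave_integral_bound\<close> at the largest frequency
    \<open>L\<close>. Assumption \<open>hL\<close> says that \<beta> (2 L + 1) <= (b - a) /
    2.\<close>
  define \<beta> where "\<beta> = ((b - a) * L * h + 2 * h) / 2"
  have meas [measurable]: "f \<in> borel_measurable borel" "w \<in> borel_measurable borel" "g \<in> borel_measurable borel"
    using A(1) unfolding f_def w_def g_def by measurable
  have bnd: "\<bar>f x\<bar> \<le> 1" "\<bar>w x\<bar> \<le> 1" for x
    by (auto simp: f_def w_def abs_mult split: split_indicator)
  have gb: "\<bar>g x\<bar> \<le> 2" for x using bnd[of x] by (simp add: g_def)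
  have f0: "f x = 0" and w0: "w x = 0" and g0: "g x = 0" if "x \<notin> {- pi..<pi}" for x
    using that A(2) ab(2) by (auto simp: f_def w_def g_def indicator_def)
  have If: "integrable lborel f"
    by (rule integrable_bounded_support[of "{- pi..<pi}" _ 1]) (use bnd f0 in auto)
  have Iw: "integrable lborel w"
    by (rule integrable_bounded_support[of "{- pi..<pi}" _ 1]) (use bnd w0 in auto)
  have II: "integrable lborel (indicator ?I :: real \<Rightarrow> real)" "(\<integral>x. indicator ?I x \<partial>lborel) = b - a"
    using ab(1) by auto
  have wb: "cmod (\<integral>x. w x *\<^sub>R exp (- \<i> * complex_of_real (of_int n * x)) \<partial>lborel) \<le> \<beta>"
    if "\<bar>n\<bar> \<le> int L" for n
  proof -
    have n: "\<bar>of_int n\<bar> \<le> real L" using that by linarith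
    have "cmod (\<integral>x. w x *\<^sub>R exp (- \<i> * complex_of_real (of_int n * x)) \<partial>lborel)
      \<le> ((b - a) * \<bar>of_int n\<bar> * h + 2 * h) / 2"
      unfolding w_def using h ab by (intro square_wave_integral_bound) auto
    also have "\<dots> \<le> \<beta>"
      unfolding \<beta>_def using n h ab(1)
      by (intro divide_right_mono add_right_mono mult_right_mono mult_left_mono) auto
    finally show ?thesis .
  qed
  have w_int: "\<bar>\<integral>x. w x \<partial>lborel\<bar> \<le> \<beta>"
    using wb[of 0] Iw by (simp add: integral_scaleR_left)
  have cw: "cmod (fourier_coeff w n) \<le> \<beta> / (2 * pi)" if "n \<in> S" for n
    using wb[OF S(3)[OF that]] by (simp add: fourier_coeff_def norm_mult norm_divide divide_simps mult.commute)
  have Ef: "(\<integral>x. f x \<partial>lborel) \<le> 2 * pi"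
  proof -
    have "(\<integral>x. f x \<partial>lborel) \<le> (\<integral>x. indicator {- pi..<pi} x \<partial>lborel)"
    proof (rule integral_mono[OF If])
      show "f x \<le> indicator {- pi..<pi} x" for x
        using A(2) by (auto simp: f_def indicator_def)
    qed simp
    then show ?thesis by simp
  qed
  \<comment> \<open>Bessel's inequality for the single frequency \<open>n\<close>; it allows squares
    to be compared with an error linear in \<beta>.\<close>
  have cf: "cmod (fourier_coeff f n) \<le> 1" for n
  proof -
    have "2 * pi * (cmod (fourier_coeff f n))\<^sup>2 \<le> (\<integral>x. (f x)\<^sup>2 \<partial>lborel)"
      using bessel_inequality[OF meas(1) bnd(1) f0, of "{n}"] by simp
    also have "(\<lambda>x. (f x)\<^sup>2) = f" by (auto simp: f_def indicator_def)
    finally have "2 * pi * (cmod (fourier_coeff f n))\<^sup>2 \<le> 2 * pi * 1\<^sup>2" using Ef by (simp only: power_one mult_1_right)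
    then have "(cmod (fourier_coeff f n))\<^sup>2 \<le> 1\<^sup>2" by (rule mult_left_le_imp_le) simp
    then show ?thesis by (rule power2_le_imp_le) simp
  qed
  have cg: "fourier_coeff g n = fourier_coeff f n - 1 / 4 * fourier_coeff w n" for n
  proof -
    have "has_bochner_integral lborel (\<lambda>x. g x *\<^sub>R exp (- \<i> * complex_of_real (of_int n * x)))
      (complex_of_real (2 * pi) * fourier_coeff f n - 1 / 4 * (complex_of_real (2 * pi) * fourier_coeff w n))"
      using has_bochner_integral_diff[OF has_integral_fourier_coeff[OF meas(1) bnd(1) f0, of n]
          has_bochner_integral_mult_right[OF has_integral_fourier_coeff[OF meas(2) bnd(2) w0, of n], of "1 / 4"]]
      by (simp add: g_def scaleR_conv_of_real algebra_simps)
    from has_bochner_integral_eq[OF has_integral_fourier_coeff[OF meas(3) gb g0] this]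
    have "complex_of_real (2 * pi) * fourier_coeff g n
      = complex_of_real (2 * pi) * (fourier_coeff f n - 1 / 4 * fourier_coeff w n)"
      by (simp add: algebra_simps)
    then show ?thesis by simp
  qed
  \<comment> \<open>Replacing \<open>f\<close> by \<open>g\<close> costs at most 2 z with z <=
    \<beta> / (8 pi): from x <= y + z and x <= 1 follows x^2 <= y^2 + 2 z.\<close>
  have sq: "(cmod (fourier_coeff f n))\<^sup>2 \<le> (cmod (fourier_coeff g n))\<^sup>2 + \<beta> / (4 * pi)" if n: "n \<in> S" for n
  proof -
    define x y z where "x = cmod (fourier_coeff f n)" "y = cmod (fourier_coeff g n)"
      "z = cmod (1 / 4 * fourier_coeff w n)"
    have z: "z \<le> \<beta> / (8 * pi)" using cw[OF n] by (simp add: x_y_z_def norm_divide divide_simps mult_ac)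
    have "x \<le> y + z"
      unfolding x_y_z_def using norm_triangle_ineq[of "fourier_coeff g n" "1 / 4 * fourier_coeff w n"] by (simp add: cg)
    moreover have x: "0 \<le> x" "x \<le> 1" "0 \<le> y" "0 \<le> z" using cf by (auto simp: x_y_z_def)
    ultimately have "x\<^sup>2 \<le> x * (y + z)" by (simp add: power2_eq_square mult_left_mono)
    moreover have xz: "x * z \<le> 1 * z" using x by (intro mult_right_mono) auto
    moreover have "x * (y + z) \<le> y\<^sup>2 + 2 * z"
    proof (cases "x \<le> y")
      case True
      then have "x * y \<le> y * y" using x by (intro mult_right_mono) auto
      then show ?thesis using x xz by (simp add: power2_eq_square algebra_simps)
    next
      case False
      then have "(x - y) * y \<le> z * 1"
        using x \<open>x \<le> y + z\<close> by (intro mult_mono) auto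
      then show ?thesis using xz by (simp add: power2_eq_square algebra_simps)
    qed
    ultimately show ?thesis using z by (simp add: x_y_z_def)
  qed
  have \<beta>0: "\<beta> \<ge> 0" using h ab(1) by (simp add: \<beta>_def)
  have "2 * pi * (\<Sum>n\<in>S. (cmod (fourier_coeff f n))\<^sup>2)
      \<le> 2 * pi * (\<Sum>n\<in>S. (cmod (fourier_coeff g n))\<^sup>2 + \<beta> / (4 * pi))"
    by (intro mult_left_mono sum_mono sq) auto
  also have "\<dots> = 2 * pi * (\<Sum>n\<in>S. (cmod (fourier_coeff g n))\<^sup>2) + real (card S) * \<beta> / 2"
    by (simp add: sum.distrib distrib_left)
  also have "\<dots> \<le> (\<integral>x. (g x)\<^sup>2 \<partial>lborel) + real L * \<beta> / 2"
    using bessel_inequality[OF meas(3) gb g0 S(1)] S(2) \<beta>0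
    by (intro add_mono divide_right_mono mult_right_mono) auto
  \<comment> \<open>On \<open>?I\<close> the stripes give f = (1 + w) / 2, so (f, w) is (1, 1) or
    (0, -1), and \<open>g\<close> is 3/4 or 1/4. Off \<open>?I\<close> the wave is 0 and f^2 =
    f.\<close>
  also have "(\<lambda>x. (g x)\<^sup>2) = (\<lambda>x. f x - 3 / 16 * indicator ?I x - 1 / 4 * w x)"
  proof
    fix x
    show "(g x)\<^sup>2 = f x - 3 / 16 * indicator ?I x - 1 / 4 * w x"
      using Ah[of x] by (auto simp: g_def f_def w_def square_wave_def indicator_def power2_eq_square)
  qed
  also have "(\<integral>x. f x - 3 / 16 * indicator ?I x - 1 / 4 * w x \<partial>lborel)
      = (\<integral>x. f x \<partial>lborel) - 3 / 16 * (b - a) - 1 / 4 * (\<integral>x. w x \<partial>lborel)"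
    using If Iw II by simp
  \<comment> \<open>The gain is 3/16 (b - a). The mean of the wave and the errors from at most
    \<open>L\<close> frequencies together cost at most \<beta> (2 L + 1) / 4 <= 2/16 (b -
    a).\<close>
  also have "\<dots> + real L * \<beta> / 2 \<le> (\<integral>x. f x \<partial>lborel) - (b - a) / 16"
  proof -
    have "\<beta> * (2 * L + 1) \<le> (b - a) / 2" using hL by (simp add: \<beta>_def)
    then have "\<beta> / 4 + real L * \<beta> / 2 \<le> (b - a) / 8" by (simp add: algebra_simps)
    then show ?thesis using w_int by argo
  qed
  finally have "2 * pi * (\<Sum>n\<in>S. (cmod (fourier_coeff f n))\<^sup>2) \<le> (\<integral>x. f x \<partial>lborel) - (b - a) / 16" .
  moreover have "Re (fourier_coeff f 0) = (\<integral>x. f x \<partial>lborel) / (2 * pi)"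
    using If by (simp add: fourier_coeff_def integral_scaleR_left)
  ultimately have "Re (fourier_coeff f 0) - (\<Sum>n\<in>S. (cmod (fourier_coeff f n))\<^sup>2) \<ge> (b - a) / (32 * pi)"
    by (simp add: field_simps)
  then show ?thesis by (simp add: f_def)
qed

section \<open>Sets restricting a single coordinate\<close>

definition slab :: "'d::finite \<Rightarrow> real set \<Rightarrow> (real^'d) set" where
  "slab i0 A = {a \<in> torus_box. a $ i0 \<in> A}"

lemma slab_alt:
  assumes "A \<subseteq> {- pi..<pi}"
  shows "slab i0 A = {a. \<forall>i. a $ i \<in> (if i = i0 then A else {- pi..<pi})}"
  using assms by (auto simp: slab_def torus_box_alt split: if_splits)

lemma borel_slab:
  assumes [measurable]: "A \<in> sets borel"
  shows "slab i0 A \<in> sets borel"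
  unfolding slab_def torus_box_alt by measurable

text \<open>The unrestricted coordinates run over a full period and contribute Kronecker deltas, so
  \<open>Q\<close> couples only points on a common line in direction \<open>i0\<close>.\<close>

lemma symbolQ_slab:
  assumes A: "A \<in> sets borel" "A \<subseteq> {- pi..<pi}"
  shows "symbolQ (slab i0 A) k l =
    (if \<forall>i. i \<noteq> i0 \<longrightarrow> l i = k i then fourier_coeff (indicator A) (l i0 - k i0) else 0)"
proof -
  have "symbolQ (slab i0 A) k l
      = (\<Prod>i\<in>UNIV. fourier_coeff (indicator (if i = i0 then A else {- pi..<pi})) (l i - k i))"
    unfolding slab_alt[OF A(2)] by (rule symbolQ_product_set) (use A in auto)
  also have "\<dots> = fourier_coeff (indicator A) (l i0 - k i0) * (\<Prod>i\<in>UNIV - {i0}. if l i = k i then 1 else 0)"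
    by (subst prod.remove[of _ i0]) (auto simp: fourier_coeff_period intro!: prod.cong)
  also have "(\<Prod>i\<in>UNIV - {i0}. if l i = k i then 1 else 0) = (if \<forall>i. i \<noteq> i0 \<longrightarrow> l i = k i then 1 else 0 :: complex)"
    by auto
  finally show ?thesis by auto
qed

lemma index_box_PiE: "index_box L = PiE UNIV (\<lambda>_. {1..int L})"
  by (auto simp: index_box_def PiE_def Pi_def extensional_def)

lemma finite_index_box: "finite (index_box L)"
  unfolding index_box_PiE by (intro finite_PiE) auto

lemma card_index_box: "card (index_box L :: ('d::finite \<Rightarrow> int) set) = L ^ CARD('d)"
  unfolding index_box_PiE by (subst card_PiE) auto

lemma sum_index_box_line:
  assumes k: "k \<in> index_box L"
  shows "(\<Sum>l\<in>index_box L. if \<forall>i. i \<noteq> i0 \<longrightarrow> l i = k i then g (l i0) else 0) = (\<Sum>m\<in>{1..int L}. g m)"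
proof -
  have "(\<Sum>l\<in>index_box L. if \<forall>i. i \<noteq> i0 \<longrightarrow> l i = k i then g (l i0) else 0)
     = (\<Sum>l | l \<in> index_box L \<and> (\<forall>i. i \<noteq> i0 \<longrightarrow> l i = k i). g (l i0))"
    by (rule sum.inter_filter[OF finite_index_box, symmetric])
  also have "\<dots> = (\<Sum>m\<in>{1..int L}. g m)"
    by (rule sum.reindex_bij_witness[of _ "\<lambda>m. k(i0 := m)" "\<lambda>l. l i0"])
       (use k in \<open>auto simp: index_box_def fun_eq_iff\<close>)
  finally show ?thesis .
qed

text \<open>The diagonal entry of Q - Q^2 at \<open>k\<close> is the Fourier tail over the
  frequencies m - \<open>k i0\<close> with 1 <= m <= L, to which \<open>fourier_tail_ge\<close>
  applies. Summing over L^d points and using the factor 2 of \<open>entropy_char_sum_ge\<close>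
  turns 1 / (32 pi) into 1 / (16 pi).\<close>

lemma entropy_slab_ge:
  fixes i0 :: "'d::finite" and a b h :: real and L :: nat
  assumes A: "A \<in> sets borel" "A \<subseteq> {- pi..<pi}"
    and ab: "a < b" "{a..<b} \<subseteq> {- pi..<pi}" and h: "h > 0"
    and Ah: "\<And>x. x \<in> {a..<b} \<Longrightarrow> x \<in> A \<longleftrightarrow> even \<lfloor>x / h\<rfloor>"
    and hL: "((b - a) * L * h + 2 * h) * (2 * L + 1) \<le> b - a"
  shows "entropy_SL (slab i0 A) L \<ge> real L ^ CARD('d) * ((b - a) / (16 * pi))"
proof -
  let ?M = "slab i0 A" and ?S = "index_box L :: ('d \<Rightarrow> int) set"
  define c where "c = fourier_coeff (indicator A)"
  have M: "?M \<in> sets borel" "?M \<subseteq> torus_box"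
    using borel_slab[OF A(1)] by (auto simp: slab_def)
  have row: "Re (symbolQ ?M k k - (\<Sum>l\<in>?S. symbolQ ?M k l * symbolQ ?M l k)) \<ge> (b - a) / (32 * pi)"
    if k: "k \<in> ?S" for k
  proof -
    have "(\<Sum>l\<in>?S. symbolQ ?M k l * symbolQ ?M l k)
       = (\<Sum>l\<in>?S. if \<forall>i. i \<noteq> i0 \<longrightarrow> l i = k i then complex_of_real ((cmod (c (l i0 - k i0)))\<^sup>2) else 0)"
    proof (intro sum.cong refl)
      fix l
      have "c (k i0 - l i0) = cnj (c (l i0 - k i0))"
        using fourier_coeff_uminus[of _ "l i0 - k i0"] by (simp add: c_def)
      then show "symbolQ ?M k l * symbolQ ?M l k
        = (if \<forall>i. i \<noteq> i0 \<longrightarrow> l i = k i then complex_of_real ((cmod (c (l i0 - k i0)))\<^sup>2) else 0)"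
        by (simp add: symbolQ_slab[OF A] c_def[symmetric] complex_norm_square del: of_real_power) metis
    qed
    also have "\<dots> = (\<Sum>m\<in>{1..int L}. complex_of_real ((cmod (c (m - k i0)))\<^sup>2))"
      by (rule sum_index_box_line[OF k])
    also have "\<dots> = (\<Sum>n\<in>(\<lambda>m. m - k i0) ` {1..int L}. complex_of_real ((cmod (c n))\<^sup>2))"
      by (subst sum.reindex) (auto simp: inj_on_def)
    finally have "Re (symbolQ ?M k k - (\<Sum>l\<in>?S. symbolQ ?M k l * symbolQ ?M l k))
      = Re (c 0) - (\<Sum>n\<in>(\<lambda>m. m - k i0) ` {1..int L}. (cmod (c n))\<^sup>2)"
      by (simp add: symbolQ_slab[OF A] c_def del: of_real_power)
    also have "\<dots> \<ge> (b - a) / (32 * pi)"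
      unfolding c_def
    proof (rule fourier_tail_ge[OF A ab h Ah hL])
      show "card ((\<lambda>m. m - k i0) ` {1..int L}) \<le> L"
        using card_image_le[of "{1..int L}" "\<lambda>m. m - k i0"] by simp
      have "1 \<le> k i0" "k i0 \<le> int L" using k by (auto simp: index_box_def)
      then show "\<bar>n\<bar> \<le> int L" if "n \<in> (\<lambda>m. m - k i0) ` {1..int L}" for n
        using that by auto
    qed auto
    finally show ?thesis .
  qed
  have "real L ^ CARD('d) * ((b - a) / (16 * pi)) = 2 * (\<Sum>k\<in>?S. (b - a) / (32 * pi))"
    by (simp add: card_index_box)
  also have "\<dots> \<le> 2 * (\<Sum>k\<in>?S. Re (symbolQ ?M k k - (\<Sum>l\<in>?S. symbolQ ?M k l * symbolQ ?M l k)))"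
    by (intro mult_left_mono sum_mono row) auto
  also have "\<dots> \<le> entropy_SL ?M L"
    using entropy_char_sum_ge[OF finite_index_box symbolQ_form_bounds[OF M finite_index_box], of L]
    unfolding entropy_SL_def charpoly_QL_def char_sum_def by (simp only: Re_sum)
  finally show ?thesis .
qed

section \<open>Stripes on dyadic scales and the choice of thresholds\<close>

lemma dyadic_intervals_disjoint:
  fixes x :: real
  assumes "x \<in> {(1/2) ^ Suc i..<(1/2) ^ i}" "x \<in> {(1/2) ^ Suc j..<(1/2) ^ j}"
  shows "i = j"
proof -
  have "\<not> i < j" if "x \<in> {(1/2) ^ Suc i..<(1/2) ^ i}" "x \<in> {(1/2) ^ Suc j..<(1/2) ^ j}" for i j
  proof
    assume "i < j"
    then have "(1/2 :: real) ^ j \<le> (1/2) ^ Suc i" by (intro power_decreasing) auto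
    then show False using that by auto
  qed
  then show ?thesis using assms by (meson linorder_neqE_nat)
qed

theorem theorem2:
  fixes F :: "nat \<Rightarrow> real"
  assumes "\<And>L. F L > 0"
    and "(\<lambda>L. F L / real L ^ CARD('d::finite)) \<longlonglongrightarrow> 0"
  shows "\<exists>M :: (real^'d) set. M \<in> sets lebesgue \<and> M \<subseteq> torus_box \<and>
           (\<forall>\<^sub>F L in sequentially. entropy_SL M L \<ge> F L)"
proof -
  define \<delta> :: "nat \<Rightarrow> real" where "\<delta> j = (1/2) ^ Suc j" for j
  have \<delta>: "\<delta> j > 0" "\<delta> j \<le> 1" for j
    using power_le_one[of "1/2 :: real" "Suc j"] by (simp_all only: \<delta>_def) auto
  have "\<exists>K. \<forall>L\<ge>K. F L / real L ^ CARD('d) < \<delta> j / (16 * pi)" for j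
    using order_tendstoD(2)[OF assms(2), of "\<delta> j / (16 * pi)"] \<delta>(1)[of j]
    by (auto simp: eventually_sequentially)
  then obtain K0 where K0: "\<And>j L. K0 j \<le> L \<Longrightarrow> F L / real L ^ CARD('d) < \<delta> j / (16 * pi)" by metis
  \<comment> \<open>The summand \<open>j\<close> ensures K j >= j, so that only finitely many
    thresholds lie below a given \<open>L\<close>.\<close>
  define K where "K j = K0 j + j" for j
  \<comment> \<open>Chosen so that \<open>hL\<close> holds for every L < K (j + 1): with T = K (j +
    1) + 2, the factor multiplying \<open>h j\<close> there is at most 2 T^2.\<close>
  define h where "h j = \<delta> j / (2 * (real (K (Suc j)) + 2)\<^sup>2)" for j
  define I :: "nat \<Rightarrow> real set" where "I j = {(1/2) ^ Suc j..<(1/2) ^ j}" for j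
  define A where "A = (\<Union>j. {x \<in> I j. even \<lfloor>x / h j\<rfloor>})"
  have h: "h j > 0" for j using \<delta>(1)[of j] by (simp add: h_def)
  have I: "I j \<subseteq> {- pi..<pi}" for j
  proof
    fix x assume "x \<in> I j"
    then have "0 \<le> x" "x < 1"
      using power_le_one[of "1/2 :: real" j] by (auto simp: I_def intro: order.trans[rotated])
    then show "x \<in> {- pi..<pi}" using pi_gt3 by auto
  qed
  have A: "A \<in> sets borel" "A \<subseteq> {- pi..<pi}"
  proof -
    show "A \<in> sets borel" unfolding A_def I_def by measurable
    show "A \<subseteq> {- pi..<pi}" using I unfolding A_def by blast
  qed
  \<comment> \<open>A point lies in only one of the intervals, so the stripes of the other scales do
    not interfere on \<open>I j\<close>.\<close>
  have AI: "x \<in> A \<longleftrightarrow> even \<lfloor>x / h j\<rfloor>" if "x \<in> I j" for x j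
    using that dyadic_intervals_disjoint[of x] unfolding A_def I_def by blast
  fix i0 :: 'd
  have "entropy_SL (slab i0 A) L \<ge> F L" if L: "L \<ge> max 1 (K 0)" for L
  proof -
    have fin: "finite {j. K j \<le> L}" by (rule finite_subset[of _ "{..L}"]) (auto simp: K_def)
    \<comment> \<open>The largest index whose threshold \<open>L\<close> has reached; it exists
      because K 0 <= L. Maximality gives L < K (j + 1), so the stripes in \<open>I j\<close> are
      thin enough for this \<open>L\<close>.\<close>
    define j where "j = Max {j. K j \<le> L}"
    have j: "K j \<le> L" using Max_in[OF fin] L by (auto simp: j_def)
    have j': "L < K (Suc j)" using Max_ge[OF fin, of "Suc j"] by (auto simp: j_def[symmetric] not_le[symmetric])
    have len: "(1/2) ^ j - (1/2) ^ Suc j = \<delta> j" by (simp add: \<delta>_def)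
    have "real L ^ CARD('d) * (((1/2) ^ j - (1/2) ^ Suc j) / (16 * pi)) \<le> entropy_SL (slab i0 A) L"
    proof (rule entropy_slab_ge[OF A _ I[unfolded I_def] h AI[unfolded I_def]])
      define T where "T = real (K (Suc j)) + 2"
      have T: "real L + 2 \<le> T" "0 < T" using j' by (auto simp: T_def)
      have "(\<delta> j * L * h j + 2 * h j) * (2 * L + 1) = h j * ((\<delta> j * L + 2) * (2 * L + 1))"
        by (simp add: algebra_simps)
      also have "\<dots> \<le> h j * (T * (2 * T))"
        using T \<delta>[of j] h[of j] mult_right_mono[of "\<delta> j" 1 "real L"]
        by (intro mult_left_mono mult_mono) auto
      also have "\<dots> = \<delta> j"
        using T(2) by (simp add: h_def T_def[symmetric] power2_eq_square)
      finally show "(((1/2) ^ j - (1/2) ^ Suc j) * real L * h j + 2 * h j) * real (2 * L + 1)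
          \<le> (1/2) ^ j - (1/2) ^ Suc j"
        unfolding len by simp
    qed auto
    moreover have "F L \<le> real L ^ CARD('d) * (\<delta> j / (16 * pi))"
      using K0[of j L] j L by (simp add: K_def divide_less_eq mult.commute)
    ultimately show ?thesis unfolding len by simp
  qed
  then have "\<forall>\<^sub>F L in sequentially. entropy_SL (slab i0 A) L \<ge> F L"
    unfolding eventually_sequentially by blast
  moreover have "slab i0 A \<in> sets lebesgue" using borel_slab[OF A(1)]
    by (intro sets_completionI_sets) simp
  moreover have "slab i0 A \<subseteq> torus_box" by (auto simp: slab_def)
  ultimately show ?thesis by blast
qed

end
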